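(* Let $R$ be an integral domain. Then the $ax+b$-semigroup $R\rtimes R^\times$ satisfies Clifford's condition if and only if $R$ is a GCD domain.
   Context: $R^\times=R\setminus\{0\}$. The $ax+b$-semigroup $R\rtimes R^\times$ is the set $R\times R^\times$ with product $(b,a)(d,c)=(b+ad,ac)$. A semigroup $S$ (with identity) satisfies Clifford's condition if for all $s,t\in S$, either $sS\cap tS=\varnothing$ or there is $r\in S$ with $sS\cap tS=rS$. An integral domain $R$ is a GCD domain if every pair $a,b\in R^\times$ has a least common multiple, i.e. an element $c\in R^\times$ divisible by both $a$ and $b$ such that $c$ divides every $c'\in R^\times$ that is divisible by both $a$ and $b$ (equivalently, every pair has a greatest common divisor). *)

theory Defs
  imports "HOL-Algebra.Ring" "HOL-Algebra.Coset" "HOL-Algebra.Divisibility"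
begin

abbreviation nonzero :: "('a, 'm) ring_scheme \<Rightarrow> 'a set" where
  "nonzero R \<equiv> carrier R - {\<zero>\<^bsub>R\<^esub>}"

text \<open>
  A pair \<^term>\<open>(b, a)\<close> stands for the affine map sending \<open>x\<close> to \<open>a x + b\<close>: the additive
  part comes first.
\<close>

definition ax_plus_b :: "('a, 'm) ring_scheme \<Rightarrow> ('a \<times> 'a) monoid" where
  "ax_plus_b R =
    \<lparr>carrier = carrier R \<times> nonzero R,
     monoid.mult = (\<lambda>(b, a) (d, c). (b \<oplus>\<^bsub>R\<^esub> (a \<otimes>\<^bsub>R\<^esub> d), a \<otimes>\<^bsub>R\<^esub> c)),
     one = (\<zero>\<^bsub>R\<^esub>, \<one>\<^bsub>R\<^esub>)\<rparr>"

text \<open>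
  The library's left coset notation, applied to the whole carrier, gives the principal right
  ideal \<open>sS\<close>; no inverses are involved.
\<close>

definition clifford_condition :: "('a, 'm) monoid_scheme \<Rightarrow> bool" where
  "clifford_condition S \<longleftrightarrow>
    (\<forall>s \<in> carrier S. \<forall>t \<in> carrier S.
      (s <#\<^bsub>S\<^esub> carrier S) \<inter> (t <#\<^bsub>S\<^esub> carrier S) = {} \<or>
      (\<exists>r \<in> carrier S.
        (s <#\<^bsub>S\<^esub> carrier S) \<inter> (t <#\<^bsub>S\<^esub> carrier S) = r <#\<^bsub>S\<^esub> carrier S))"

locale gcd_domain = domain R for R (structure) +
  assumes lcm_exists:
    "\<lbrakk>a \<in> nonzero R; b \<in> nonzero R\<rbrakk> \<Longrightarrow>
      \<exists>c \<in> nonzero R. a divides c \<and> b divides c \<and>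
        (\<forall>c' \<in> nonzero R. a divides c' \<and> b divides c' \<longrightarrow> c divides c')"

lemma (in domain) ax_plus_b_monoid: "monoid (ax_plus_b R)"
  by (rule monoidI)
    (auto simp: ax_plus_b_def integral_iff r_distr m_assoc a_assoc)

text \<open>
  The library's \<^const>\<open>islcm\<close> over a ring also tests common multiples equal to zero, which
  makes no difference since everything divides zero.
\<close>

lemma (in domain) islcm_iff_nonzero:
  assumes "c \<in> nonzero R"
  shows "c lcmof a b \<longleftrightarrow>
    a divides c \<and> b divides c \<and>
      (\<forall>c' \<in> nonzero R. a divides c' \<and> b divides c' \<longrightarrow> c divides c')"
proof -
  have "c divides \<zero>"
    using assms by (auto simp: factor_def intro!: bexI[of _ \<zero>])
  then show ?thesis
    unfolding islcm_def by blast
qed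

end

theory Submission
  imports Defs
begin

text \<open>
  The principal right ideal of \<open>(b, a)\<close> is \<open>(b + aR) \<times> aR\<^sup>\<times>\<close>. If two such ideals share a
  point with first component \<open>x\<close>, then both translations may be taken to be \<open>x\<close>, and the
  intersection is \<open>(x + (aR \<inter> cR)) \<times> (aR \<inter> cR)\<^sup>\<times>\<close>, so it is principal as soon as \<open>a\<close> and \<open>c\<close>
  have a least common multiple. Conversely, a generator of \<open>(0, a)S \<inter> (0, b)S\<close>, which contains
  \<open>(0, ab)\<close>, has a least common multiple of \<open>a\<close> and \<open>b\<close> as second component.
\<close>

context domain
begin

lemma divides_zero_right [simp]: "a \<in> carrier R \<Longrightarrow> a divides \<zero>"
  by (auto simp: factor_def intro!: bexI[of _ \<zero>])

lemma divides_minus: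
  assumes "a divides x" "a divides y" "a \<in> carrier R"
  shows "a divides (x \<ominus> y)"
proof -
  obtain p q where "p \<in> carrier R" "q \<in> carrier R" "x = a \<otimes> p" "y = a \<otimes> q"
    using assms by (auto simp: factor_def)
  then have "x \<ominus> y = a \<otimes> (p \<ominus> q)"
    using assms(3) by (simp add: minus_eq r_distr r_minus)
  with \<open>p \<in> carrier R\<close> \<open>q \<in> carrier R\<close> show ?thesis
    by (auto simp: factor_def)
qed

text \<open>The first hypothesis places \<open>x\<close> in the coset \<open>b + aR\<close>, so
  \<open>b + aR = x + aR\<close>: any point of a coset can serve as its base point.\<close>

lemma divides_diff_shift:
  assumes "a divides (x \<ominus> b)"
    and "a \<in> carrier R" "b \<in> carrier R" "x \<in> carrier R" "u \<in> carrier R"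
  shows "a divides (u \<ominus> b) \<longleftrightarrow> a divides (u \<ominus> x)"
proof
  have "u \<ominus> x = (u \<ominus> b) \<ominus> (x \<ominus> b)"
    using assms(2-) by algebra
  then show "a divides (u \<ominus> x)" if "a divides (u \<ominus> b)"
    using divides_minus[OF that assms(1,2)] by simp
next
  assume *: "a divides (u \<ominus> x)"
  \<comment> \<open>Writing \<open>b - x\<close> as a difference from zero lets
    \<open>divides_minus\<close> handle sums as well.\<close>
  have "a divides (\<zero> \<ominus> (x \<ominus> b))"
    using assms by (intro divides_minus[OF _ assms(1)]) auto
  moreover have "u \<ominus> b = (u \<ominus> x) \<ominus> (\<zero> \<ominus> (x \<ominus> b))"
    using assms(2-) by algebra
  ultimately show "a divides (u \<ominus> b)"
    using divides_minus[OF * _ assms(2)] by simp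
qed

text \<open>Solving \<open>(b, a)(d, c) = (u, v)\<close> means finding \<open>d\<close> with
  \<open>u - b = ad\<close> and \<open>c\<close> with \<open>v = ac\<close>; as there are no zero
  divisors, \<open>c\<close> is nonzero exactly when \<open>v\<close> is. Both directions of the
  theorem then reduce to divisibility in \<open>R\<close>.\<close>

lemma mem_principal_ax_plus_b_iff:
  assumes "b \<in> carrier R" "a \<in> nonzero R"
  shows "(u, v) \<in> (b, a) <#\<^bsub>ax_plus_b R\<^esub> carrier (ax_plus_b R) \<longleftrightarrow>
    u \<in> carrier R \<and> v \<in> nonzero R \<and> a divides (u \<ominus> b) \<and> a divides v"
    (is "?L \<longleftrightarrow> ?R")
proof
  assume ?L
  then obtain d c where dc: "d \<in> carrier R" "c \<in> nonzero R" "u = b \<oplus> a \<otimes> d" "v = a \<otimes> c"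
    by (auto simp: l_coset_def ax_plus_b_def)
  have "a \<in> carrier R"
    using assms by simp
  then have "b \<oplus> a \<otimes> d \<ominus> b = a \<otimes> d"
    using assms(1) dc(1) by algebra
  with assms dc show ?R
    by (auto simp: factor_def integral_iff)
next
  assume R: ?R
  then obtain d c where dc: "d \<in> carrier R" "c \<in> carrier R" "u \<ominus> b = a \<otimes> d" "v = a \<otimes> c"
    by (auto simp: factor_def)
  have "u = b \<oplus> (u \<ominus> b)"
    using R assms by algebra
  with dc have "u = b \<oplus> a \<otimes> d"
    by simp
  moreover have "c \<noteq> \<zero>"
    using R dc assms by auto
  ultimately show ?L
    using dc assms by (auto simp: l_coset_def ax_plus_b_def)
qed

lemma gcd_domain_if_clifford_condition:
  assumes "clifford_condition (ax_plus_b R)"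
  shows "gcd_domain R"
proof unfold_locales
  fix a b
  assume a: "a \<in> nonzero R" and b: "b \<in> nonzero R"
  define I where "I s = s <#\<^bsub>ax_plus_b R\<^esub> carrier (ax_plus_b R)" for s
  \<comment> \<open>With both first components zero, the condition on the translation becomes that
    \<open>x\<close> divides zero, so only the second components matter.\<close>
  have I_zero: "(\<zero>, v) \<in> I (\<zero>, x) \<longleftrightarrow> v \<in> nonzero R \<and> x divides v" if "x \<in> nonzero R" for x v
    using that unfolding I_def by (subst mem_principal_ax_plus_b_iff) (auto simp: minus_eq)
  \<comment> \<open>The product is a common multiple, which excludes the empty case of Clifford's
    condition.\<close>
  have "a divides (a \<otimes> b)" "b divides (a \<otimes> b)"
    using a b m_comm[of a b] unfolding factor_def by blast+
  then have "(\<zero>, a \<otimes> b) \<in> I (\<zero>, a) \<inter> I (\<zero>, b)"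
    using a b by (simp add: I_zero integral_iff)
  moreover have "(\<zero>, a) \<in> carrier (ax_plus_b R)" "(\<zero>, b) \<in> carrier (ax_plus_b R)"
    using a b by (auto simp: ax_plus_b_def)
  ultimately obtain r where r: "r \<in> carrier (ax_plus_b R)" "I (\<zero>, a) \<inter> I (\<zero>, b) = I r"
    using assms unfolding clifford_condition_def I_def by blast
  obtain e c where ec: "r = (e, c)" "e \<in> carrier R" "c \<in> nonzero R"
    using r(1) by (auto simp: ax_plus_b_def)
  \<comment> \<open>A generator lies in its own ideal, hence in both given ones; this makes
    \<open>c\<close> a common multiple.\<close>
  have "(e, c) \<in> I r"
    unfolding I_def ec(1)
    using ec by (subst mem_principal_ax_plus_b_iff) (auto simp: r_neg minus_eq)
  then have "(e, c) \<in> I (\<zero>, a)" "(e, c) \<in> I (\<zero>, b)"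
    using r(2) by auto
  then have "a divides c" "b divides c"
    using a b mem_principal_ax_plus_b_iff unfolding I_def by auto
  moreover have "c divides c'" if "c' \<in> nonzero R" "a divides c'" "b divides c'" for c'
  proof -
    \<comment> \<open>Any common multiple, paired with zero, is a point of the intersection;
      membership in the ideal of the generator then yields divisibility by \<open>c\<close>.\<close>
    have "(\<zero>, c') \<in> I (\<zero>, a) \<inter> I (\<zero>, b)"
      using that a b I_zero by simp
    then have "(\<zero>, c') \<in> I (e, c)"
      using r(2) ec(1) by simp
    then show ?thesis
      unfolding I_def using mem_principal_ax_plus_b_iff[OF ec(2,3)] by simp
  qed
  ultimately show "\<exists>c \<in> nonzero R. a divides c \<and> b divides c \<and>
      (\<forall>c' \<in> nonzero R. a divides c' \<and> b divides c' \<longrightarrow> c divides c')"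
    using ec(3) by blast
qed

end

lemma (in gcd_domain) clifford_condition_ax_plus_b: "clifford_condition (ax_plus_b R)"
  unfolding clifford_condition_def
proof (intro ballI disjCI)
  define I where "I s = s <#\<^bsub>ax_plus_b R\<^esub> carrier (ax_plus_b R)" for s
  fix s t
  assume "s \<in> carrier (ax_plus_b R)" "t \<in> carrier (ax_plus_b R)"
  then obtain b a d c where s: "s = (b, a)" "b \<in> carrier R" "a \<in> nonzero R"
    and t: "t = (d, c)" "d \<in> carrier R" "c \<in> nonzero R"
    by (auto simp: ax_plus_b_def)
  assume no_generator: "\<not> (\<exists>r \<in> carrier (ax_plus_b R).
    (s <#\<^bsub>ax_plus_b R\<^esub> carrier (ax_plus_b R)) \<inter> (t <#\<^bsub>ax_plus_b R\<^esub> carrier (ax_plus_b R)) =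
      r <#\<^bsub>ax_plus_b R\<^esub> carrier (ax_plus_b R))"
  show "(s <#\<^bsub>ax_plus_b R\<^esub> carrier (ax_plus_b R)) \<inter>
    (t <#\<^bsub>ax_plus_b R\<^esub> carrier (ax_plus_b R)) = {}"
  proof (rule ccontr)
    assume "\<not> ?thesis"
    \<comment> \<open>Only \<open>x\<close> is kept: it is a common point of the cosets
      \<open>b + aR\<close> and \<open>d + cR\<close>.\<close>
    then obtain x y where "(x, y) \<in> I s" "(x, y) \<in> I t"
      unfolding I_def by fastforce
    then have x: "x \<in> carrier R" "a divides (x \<ominus> b)" "c divides (x \<ominus> d)"
      using mem_principal_ax_plus_b_iff s t unfolding I_def by auto
    obtain l where l: "l \<in> nonzero R" "a divides l" "c divides l"
      and least: "\<And>z. z \<in> nonzero R \<Longrightarrow> a divides z \<Longrightarrow> c divides z \<Longrightarrow> l divides z"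
      using lcm_exists[OF s(3) t(3)] by blast
    \<comment> \<open>This says \<open>aR \<inter> cR = lR\<close>. Zero must be included, since the
      property will be applied to \<open>u - x\<close>, which may vanish.\<close>
    have l_divides_iff: "a divides z \<and> c divides z \<longleftrightarrow> l divides z" if "z \<in> carrier R" for z
    proof (cases "z = \<zero>")
      case True
      then show ?thesis using s t l(1) by simp
    next
      case False
      then show ?thesis
        using that least[of z] l s(3) t(3) by (auto intro: divides_trans)
    qed
    have "(u, v) \<in> I s \<inter> I t \<longleftrightarrow> (u, v) \<in> I (x, l)" for u v
    proof -
      have "(u, v) \<in> I s \<inter> I t \<longleftrightarrow> u \<in> carrier R \<and> v \<in> nonzero R \<and>
          (a divides (u \<ominus> b) \<and> c divides (u \<ominus> d)) \<and> (a divides v \<and> c divides v)"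
        using mem_principal_ax_plus_b_iff s t unfolding I_def by auto
      \<comment> \<open>Both cosets are rebased at \<open>x\<close>, so that the two conditions on
        \<open>u\<close> concern the same element \<open>u - x\<close>.\<close>
      also have "\<dots> \<longleftrightarrow> u \<in> carrier R \<and> v \<in> nonzero R \<and>
          (a divides (u \<ominus> x) \<and> c divides (u \<ominus> x)) \<and> (a divides v \<and> c divides v)"
        using x s t divides_diff_shift[of a x b u] divides_diff_shift[of c x d u] by auto
      also have "\<dots> \<longleftrightarrow> (u, v) \<in> I (x, l)"
        unfolding I_def mem_principal_ax_plus_b_iff[OF x(1) l(1)]
        using x(1) l_divides_iff[of "u \<ominus> x"] l_divides_iff[of v] by auto
      finally show ?thesis .
    qed
    then have "I s \<inter> I t = I (x, l)"
      by auto
    moreover have "(x, l) \<in> carrier (ax_plus_b R)"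
      using x(1) l(1) by (simp add: ax_plus_b_def)
    ultimately show False
      using no_generator unfolding I_def by blast
  qed
qed

theorem proposition2p3p9:
  fixes R (structure)
  assumes "domain R"
  shows "clifford_condition (ax_plus_b R) \<longleftrightarrow> gcd_domain R"
  using domain.gcd_domain_if_clifford_condition[OF assms]
    gcd_domain.clifford_condition_ax_plus_b by blast

end
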